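(* Let $\lambda$ be a nonzero real number and let $x,y\in\mathbb{R}$. For every integer $n\ge 0$, $$C_{n,\lambda}(x,y)=\frac{1}{2}\left(\sum_{l=0}^{n}\binom{n}{l}(1)_{n-l,\lambda}\mathcal{E}_{l,\lambda}^{(c)}(x,y)+\mathcal{E}_{n,\lambda}^{(c)}(x,y)\right)$$ and $$S_{n,\lambda}(x,y)=\frac{1}{2}\left(\sum_{l=0}^{n}\binom{n}{l}(1)_{n-l,\lambda}\mathcal{E}_{l,\lambda}^{(s)}(x,y)+\mathcal{E}_{n,\lambda}^{(s)}(x,y)\right).$$
   Context: All generating functions are power series in $t$ around $t=0$. For nonzero $\lambda\in\mathbb{R}$ and complex $z$, the degenerate exponential is $e_\lambda^{z}(t)=(1+\lambda t)^{z/\lambda}$, and $e_\lambda(t)=e_\lambda^1(t)$. The degenerate cosine and sine functions are $\cos_\lambda^{(y)}(t)=\frac{e_\lambda^{iy}(t)+e_\lambda^{-iy}(t)}{2}=\cos\left(\frac{y}{\lambda}\log(1+\lambda t)\right)$ and $\sin_\lambda^{(y)}(t)=\frac{e_\lambda^{iy}(t)-e_\lambda^{-iy}(t)}{2i}=\sin\left(\frac{y}{\lambda}\log(1+\lambda t)\right)$, with $i=\sqrt{-1}$. The degenerate cosine-Euler and sine-Euler polynomials are defined by $\frac{2}{e_\lambda(t)+1}e_\lambda^{x}(t)\cos_\lambda^{(y)}(t)=\sum_{n=0}^{\infty}\mathcal{E}_{n,\lambda}^{(c)}(x,y)\frac{t^n}{n!}$ and $\frac{2}{e_\lambda(t)+1}e_\lambda^{x}(t)\sin_\lambda^{(y)}(t)=\sum_{n=0}^{\infty}\mathcal{E}_{n,\lambda}^{(s)}(x,y)\frac{t^n}{n!}$.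 The degenerate cosine-polynomials and sine-polynomials are defined by $e_\lambda^{x}(t)\cos_\lambda^{(y)}(t)=\sum_{n=0}^{\infty}C_{n,\lambda}(x,y)\frac{t^n}{n!}$ and $e_\lambda^{x}(t)\sin_\lambda^{(y)}(t)=\sum_{n=0}^{\infty}S_{n,\lambda}(x,y)\frac{t^n}{n!}$. The generalized falling factorials are $(x)_{0,\lambda}=1$, $(x)_{n,\lambda}=x(x-\lambda)(x-2\lambda)\cdots(x-(n-1)\lambda)$ for $n\ge1$. *)

theory Defs
  imports "HOL-Complex_Analysis.Complex_Analysis"
begin

text \<open>
  Generating functions are functions of a complex variable \<open>t\<close> near \<open>0\<close>. The power is the
  principal one; it is analytic at \<open>t = 0\<close> because \<open>1 + \<lambda>t\<close> is close to \<open>1\<close> there.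
\<close>

definition degen_exp :: "real \<Rightarrow> complex \<Rightarrow> complex \<Rightarrow> complex" where
  "degen_exp lam z t = (1 + of_real lam * t) powr (z / of_real lam)"

definition degen_cos :: "real \<Rightarrow> real \<Rightarrow> complex \<Rightarrow> complex" where
  "degen_cos lam y t =
     (degen_exp lam (\<i> * of_real y) t + degen_exp lam (- \<i> * of_real y) t) / 2"

definition degen_sin :: "real \<Rightarrow> real \<Rightarrow> complex \<Rightarrow> complex" where
  "degen_sin lam y t =
     (degen_exp lam (\<i> * of_real y) t - degen_exp lam (- \<i> * of_real y) t) / (2 * \<i>)"

text \<open>
  The coefficients \<open>a\<^sub>n\<close> in \<open>f t = (\<Sum>n. a\<^sub>n * t ^ n / n!)\<close>, for \<open>f\<close> analytic at \<open>0\<close>;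
  see \<open>egf_coeff_sums\<close> and \<open>egf_coeff_unique\<close> below.
\<close>

definition egf_coeff :: "(complex \<Rightarrow> complex) \<Rightarrow> nat \<Rightarrow> complex" where
  "egf_coeff f n = fact n * fps_nth (fps_expansion f 0) n"

text \<open>
  The numbers below are real for real arguments; they are kept in type \<^typ>\<open>complex\<close>, as coefficients
  of complex power series.
\<close>

definition degen_cos_euler :: "nat \<Rightarrow> real \<Rightarrow> real \<Rightarrow> real \<Rightarrow> complex" where
  "degen_cos_euler n lam x y =
     egf_coeff (\<lambda>t. 2 / (degen_exp lam 1 t + 1) * degen_exp lam (of_real x) t * degen_cos lam y t) n"

definition degen_sin_euler :: "nat \<Rightarrow> real \<Rightarrow> real \<Rightarrow> real \<Rightarrow> complex" where
  "degen_sin_euler n lam x y =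
     egf_coeff (\<lambda>t. 2 / (degen_exp lam 1 t + 1) * degen_exp lam (of_real x) t * degen_sin lam y t) n"

definition degen_cos_poly :: "nat \<Rightarrow> real \<Rightarrow> real \<Rightarrow> real \<Rightarrow> complex" where
  "degen_cos_poly n lam x y =
     egf_coeff (\<lambda>t. degen_exp lam (of_real x) t * degen_cos lam y t) n"

definition degen_sin_poly :: "nat \<Rightarrow> real \<Rightarrow> real \<Rightarrow> real \<Rightarrow> complex" where
  "degen_sin_poly n lam x y =
     egf_coeff (\<lambda>t. degen_exp lam (of_real x) t * degen_sin lam y t) n"

definition gen_falling_fact :: "real \<Rightarrow> nat \<Rightarrow> real \<Rightarrow> real" where
  "gen_falling_fact x n lam = (\<Prod>i<n. x - real i * lam)"


lemma egf_coeff_sums: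
  assumes "f analytic_on {0}"
  shows "eventually (\<lambda>t. (\<lambda>n. egf_coeff f n * t ^ n / fact n) sums f t) (nhds 0)"
proof -
  have F: "f has_fps_expansion fps_expansion f 0"
    using assms by (rule analytic_at_imp_has_fps_expansion_0)
  then have r: "fps_conv_radius (fps_expansion f 0) > 0"
    and e: "eventually (\<lambda>t. eval_fps (fps_expansion f 0) t = f t) (nhds 0)"
    by (auto simp: has_fps_expansion_def)
  have "eventually (\<lambda>t. t \<in> eball 0 (fps_conv_radius (fps_expansion f 0))) (nhds 0)"
    using r by (intro eventually_nhds_in_open) (auto simp: zero_ereal_def)
  with e show ?thesis
  proof eventually_elim
    case (elim t)
    have "(\<lambda>n. fps_nth (fps_expansion f 0) n * t ^ n) sums eval_fps (fps_expansion f 0) t"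
      using elim by (intro sums_eval_fps) (auto simp: in_eball_iff)
    then show ?case using elim by (simp add: egf_coeff_def)
  qed
qed

lemma egf_coeff_unique:
  assumes "eventually (\<lambda>t. (\<lambda>n. a n * t ^ n / fact n) sums f t) (nhds (0::complex))"
  shows "egf_coeff f n = a n"
proof -
  let ?A = "Abs_fps (\<lambda>n. a n / fact n)"
  have "f has_fps_expansion ?A"
    by (rule has_fps_expansionI) (use assms in \<open>simp add: field_simps\<close>)
  then have "fps_expansion f 0 = ?A" 
    by (meson fps_expansion_unique_complex has_fps_expansion_imp_analytic_0
        analytic_at_imp_has_fps_expansion_0)
  then show ?thesis by (simp add: egf_coeff_def)
qed

lemma degen_exp_analytic:
  "degen_exp lam z analytic_on {0}"
  unfolding degen_exp_def
  by (intro analytic_intros) auto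

lemma degen_cos_analytic: "degen_cos lam y analytic_on {0}"
  unfolding degen_cos_def by (intro analytic_intros degen_exp_analytic) auto

lemma degen_sin_analytic: "degen_sin lam y analytic_on {0}"
  unfolding degen_sin_def by (intro analytic_intros degen_exp_analytic) auto

lemma degen_exp_0 [simp]: "degen_exp lam z 0 = 1"
  by (simp add: degen_exp_def)

lemma degen_cos_euler_sums:
  "eventually (\<lambda>t. (\<lambda>n. degen_cos_euler n lam x y * t ^ n / fact n) sums
     (2 / (degen_exp lam 1 t + 1) * degen_exp lam (of_real x) t * degen_cos lam y t)) (nhds 0)"
  unfolding degen_cos_euler_def
  by (rule egf_coeff_sums)
     (intro analytic_intros degen_exp_analytic degen_cos_analytic; simp)

lemma degen_sin_euler_sums:
  "eventually (\<lambda>t. (\<lambda>n. degen_sin_euler n lam x y * t ^ n / fact n) sums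
     (2 / (degen_exp lam 1 t + 1) * degen_exp lam (of_real x) t * degen_sin lam y t)) (nhds 0)"
  unfolding degen_sin_euler_def
  by (rule egf_coeff_sums)
     (intro analytic_intros degen_exp_analytic degen_sin_analytic; simp)

lemma degen_cos_poly_sums:
  "eventually (\<lambda>t. (\<lambda>n. degen_cos_poly n lam x y * t ^ n / fact n) sums
     (degen_exp lam (of_real x) t * degen_cos lam y t)) (nhds 0)"
  unfolding degen_cos_poly_def
  by (rule egf_coeff_sums) (intro analytic_intros degen_exp_analytic degen_cos_analytic)

lemma degen_sin_poly_sums:
  "eventually (\<lambda>t. (\<lambda>n. degen_sin_poly n lam x y * t ^ n / fact n) sums
     (degen_exp lam (of_real x) t * degen_sin lam y t)) (nhds 0)"
  unfolding degen_sin_poly_def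
  by (rule egf_coeff_sums) (intro analytic_intros degen_exp_analytic degen_sin_analytic)

lemma degen_cos_eq_cos:
  assumes "1 + of_real lam * t \<noteq> 0"
  shows "degen_cos lam y t = cos (of_real y / of_real lam * ln (1 + of_real lam * t))"
  using assms by (simp add: degen_cos_def degen_exp_def powr_def cos_exp_eq mult_ac)

lemma degen_sin_eq_sin:
  assumes "1 + of_real lam * t \<noteq> 0"
  shows "degen_sin lam y t = sin (of_real y / of_real lam * ln (1 + of_real lam * t))"
  using assms by (simp add: degen_sin_def degen_exp_def powr_def sin_exp_eq mult_ac)

end

theory Submission
  imports Defs
begin

text \<open>
  Write \<open>e\<close> for \<open>degen_exp lam 1\<close>. Any \<open>g\<close> analytic at \<open>0\<close> satisfies
  \<open>g = (e h + h) / 2\<close> near \<open>0\<close> with \<open>h = 2 g / (e + 1)\<close>. Comparing coefficients gives the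
  theorem, since by the binomial series those of \<open>e\<close> are the numbers \<open>(1)\<^sub>n\<^sub>,\<^sub>\<lambda>\<close>.
\<close>

text \<open>Power series expansions at \<open>0\<close> are unique, so the arithmetic of
  \<open>has_fps_expansion\<close> carries over to \<open>egf_coeff\<close>.\<close>

lemma egf_coeff_eqI:
  assumes "f has_fps_expansion F"
  shows "egf_coeff f n = fact n * fps_nth F n"
proof -
  have "fps_expansion f 0 = F"
    using assms by (meson fps_expansion_unique_complex has_fps_expansion_imp_analytic_0
        analytic_at_imp_has_fps_expansion_0)
  then show ?thesis by (simp add: egf_coeff_def)
qed

text \<open>Coefficients see only the germ at \<open>0\<close>. This matters because
  \<open>degen_exp lam 1 t + 1\<close> may vanish at other points, where division by it is
  meaningless.\<close>

lemma egf_coeff_cong: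
  assumes "f analytic_on {0}" and "eventually (\<lambda>t. f t = g t) (nhds 0)"
  shows "egf_coeff f n = egf_coeff g n"
proof -
  have "g has_fps_expansion fps_expansion f 0"
    using analytic_at_imp_has_fps_expansion_0[OF assms(1)]
      has_fps_expansion_cong[OF assms(2) refl] by blast
  from egf_coeff_eqI[OF this] show ?thesis by (simp add: egf_coeff_def)
qed

lemma egf_coeff_add:
  assumes "f analytic_on {0}" and "g analytic_on {0}"
  shows "egf_coeff (\<lambda>t. f t + g t) n = egf_coeff f n + egf_coeff g n"
  using egf_coeff_eqI[OF has_fps_expansion_add[OF assms[THEN analytic_at_imp_has_fps_expansion_0]]]
  by (simp add: egf_coeff_def distrib_left)

lemma egf_coeff_mult:
  assumes "f analytic_on {0}" and "g analytic_on {0}"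
  shows "egf_coeff (\<lambda>t. f t * g t) n =
    (\<Sum>l=0..n. of_nat (n choose l) * egf_coeff f (n - l) * egf_coeff g l)"
proof -
  \<comment> \<open>The factors are swapped because \<open>fps_mult_nth\<close> gives the summation
    index to the first factor, and here \<open>l\<close> belongs to \<open>g\<close>.\<close>
  have "egf_coeff (\<lambda>t. g t * f t) n =
      fact n * fps_nth (fps_expansion g 0 * fps_expansion f 0) n"
    using assms by (intro egf_coeff_eqI has_fps_expansion_mult analytic_at_imp_has_fps_expansion_0)
  also have "\<dots> = (\<Sum>l=0..n. of_nat (n choose l) * egf_coeff f (n - l) * egf_coeff g l)"
    unfolding fps_mult_nth sum_distrib_left egf_coeff_def
    by (intro sum.cong) (simp_all add: binomial_fact)
  finally show ?thesis by (simp only: mult.commute)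
qed

lemma egf_coeff_cmult:
  assumes "f analytic_on {0}"
  shows "egf_coeff (\<lambda>t. c * f t) n = c * egf_coeff f n"
  using egf_coeff_eqI[OF has_fps_expansion_cmult_left[OF analytic_at_imp_has_fps_expansion_0[OF assms]]]
  by (simp add: egf_coeff_def)

text \<open>This is the binomial series of \<open>(1 + lam * t) powr (x / lam)\<close>, with the
  powers of \<open>lam\<close> absorbed into the binomial coefficients.\<close>

lemma egf_coeff_degen_exp:
  assumes "lam \<noteq> 0"
  shows "egf_coeff (degen_exp lam (of_real x)) n = of_real (gen_falling_fact x n lam)"
proof -
  have coeff: "of_real (gen_falling_fact x k lam) / fact k =
      (of_real x / of_real lam gchoose k) * (of_real lam ^ k :: complex)" for k
  proof -
    have "(\<Prod>i<k. complex_of_real x - of_nat i * of_real lam) =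
        (\<Prod>i<k. (of_real x / of_real lam - of_nat i) * of_real lam)"
      using assms by (intro prod.cong) (auto simp: field_simps)
    then show ?thesis
      by (simp add: gen_falling_fact_def gbinomial_prod_rev prod.distrib atLeast0LessThan)
  qed
  \<comment> \<open>On this disc \<open>lam * t\<close> has norm below 1, so the binomial series
    converges.\<close>
  have "eventually (\<lambda>t::complex. t \<in> ball 0 (1 / \<bar>lam\<bar>)) (nhds 0)"
    using assms by (intro eventually_nhds_in_open) auto
  then have "eventually (\<lambda>t. (\<lambda>k. of_real (gen_falling_fact x k lam) * t ^ k / fact k)
      sums degen_exp lam (of_real x) t) (nhds 0)"
  proof eventually_elim
    case (elim t)
    then have "norm (of_real lam * t) < 1"
      using assms by (simp add: norm_mult field_simps)
    from gen_binomial_complex[OF this, of "of_real x / of_real lam"]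
    have "(\<lambda>k. (of_real (gen_falling_fact x k lam) / fact k) * t ^ k)
        sums degen_exp lam (of_real x) t"
      by (simp add: coeff degen_exp_def power_mult_distrib mult_ac)
    then show ?case by simp
  qed
  then show ?thesis by (rule egf_coeff_unique)
qed

text \<open>With \<open>g\<close> left arbitrary, the cosine and sine identities are both instances:
  \<open>h\<close> becomes the generating function of the corresponding Euler polynomials.\<close>

lemma egf_coeff_eq_euler:
  assumes "lam \<noteq> 0" and g: "g analytic_on {0}"
  defines "h \<equiv> \<lambda>t. 2 / (degen_exp lam 1 t + 1) * g t"
  shows "egf_coeff g n =
    1 / 2 * ((\<Sum>l=0..n. of_nat (n choose l) * of_real (gen_falling_fact 1 (n - l) lam)
                * egf_coeff h l)
             + egf_coeff h n)"
proof -
  note e = degen_exp_analytic[of lam 1]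
  have h: "h analytic_on {0}"
    unfolding h_def by (intro analytic_intros e g) simp
  have eh: "(\<lambda>t. degen_exp lam 1 t * h t) analytic_on {0}"
    by (intro analytic_intros e h)
  \<comment> \<open>The denominator equals 2 at \<open>0\<close>, so by continuity it is nonzero
    nearby and can be cleared.\<close>
  have "isCont (\<lambda>t. degen_exp lam 1 t + 1) 0"
    by (intro analytic_at_imp_isCont analytic_intros e)
  then have "eventually (\<lambda>t. degen_exp lam 1 t + 1 \<noteq> 0) (nhds 0)"
    unfolding isCont_def
    by (intro tendsto_imp_eventually_ne[OF iffD1[OF tendsto_at_iff_tendsto_nhds]]) simp_all
  then have "eventually (\<lambda>t. g t = 1 / 2 * (degen_exp lam 1 t * h t + h t)) (nhds 0)"
  proof eventually_elim
    case (elim t)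
    then have "(degen_exp lam 1 t + 1) * h t = 2 * g t" by (simp add: h_def)
    then show ?case by (simp add: distrib_right)
  qed
  with g have "egf_coeff g n = egf_coeff (\<lambda>t. 1 / 2 * (degen_exp lam 1 t * h t + h t)) n"
    by (rule egf_coeff_cong)
  also have "\<dots> = 1 / 2 * (egf_coeff (\<lambda>t. degen_exp lam 1 t * h t) n + egf_coeff h n)"
    using analytic_on_add[OF eh h] eh h by (simp only: egf_coeff_cmult egf_coeff_add)
  finally show ?thesis
    using egf_coeff_degen_exp[OF assms(1), of 1] by (simp add: egf_coeff_mult[OF e h])
qed

theorem theorem2p4:
  fixes lam x y :: real and n :: nat
  assumes "lam \<noteq> 0"
  shows "degen_cos_poly n lam x y =
           1 / 2 * ((\<Sum>l=0..n. of_nat (n choose l) * of_real (gen_falling_fact 1 (n - l) lam)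
                       * degen_cos_euler l lam x y)
                    + degen_cos_euler n lam x y)
       \<and> degen_sin_poly n lam x y =
           1 / 2 * ((\<Sum>l=0..n. of_nat (n choose l) * of_real (gen_falling_fact 1 (n - l) lam)
                       * degen_sin_euler l lam x y)
                    + degen_sin_euler n lam x y)"
  \<comment> \<open>Reassociating the triple products exposes the form
    \<open>2 / (degen_exp lam 1 t + 1) * g t\<close>.\<close>
  unfolding degen_cos_poly_def degen_cos_euler_def degen_sin_poly_def degen_sin_euler_def mult.assoc
  using assms
  by (intro conjI egf_coeff_eq_euler[unfolded mult.assoc] analytic_on_mult
      degen_exp_analytic degen_cos_analytic degen_sin_analytic)

end
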